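(* Let $m\ge n$ and let $\Vert\cdot\Vert_2:\mathbb{DR}^{m\times n}\to\mathbb{DR}$ be the dual continuation of the matrix spectral norm on $\mathbb{R}^{m\times n}$. For every $\boldsymbol{A}=\boldsymbol{A}_{\rm s}+\boldsymbol{A}_{\rm i}\epsilon\in\mathbb{DR}^{m\times n}$, $$\Vert\boldsymbol{A}\Vert_2=\begin{cases}\Vert\boldsymbol{A}_{\rm s}\Vert_2+\lambda_{\max}(\boldsymbol{R})\,\epsilon, & \boldsymbol{A}_{\rm s}\ne\boldsymbol{O},\\ \Vert\boldsymbol{A}_{\rm i}\Vert_2\,\epsilon, & \boldsymbol{A}_{\rm s}=\boldsymbol{O},\end{cases}$$ where $\boldsymbol{R}=\mathrm{sym}(\boldsymbol{U}_{r_1}^\top\boldsymbol{A}_{\rm i}\boldsymbol{V}_{r_1})$, $\lambda_{\max}(\boldsymbol{R})$ is its largest eigenvalue, and $\boldsymbol{U}_{r_1}\in\mathbb{R}^{m\times r_1}$, $\boldsymbol{V}_{r_1}\in\mathbb{R}^{n\times r_1}$ consist of the left and right singular vectors (in a full SVD of $\boldsymbol{A}_{\rm s}$) corresponding to the largest singular value of $\boldsymbol{A}_{\rm s}$, whose multiplicity is $r_1$.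
   Context: Dual numbers: $\mathbb{DR}=\{p_{\rm s}+p_{\rm i}\epsilon: p_{\rm s},p_{\rm i}\in\mathbb{R}\}$ with $\epsilon\neq0$, $\epsilon^2=0$. Dual matrices are written $\boldsymbol{A}=\boldsymbol{A}_{\rm s}+\boldsymbol{A}_{\rm i}\epsilon$ with $\boldsymbol{A}_{\rm s},\boldsymbol{A}_{\rm i}$ real. Gâteaux derivative: $\mathcal{D}_u\phi(x)=\lim_{t\downarrow0}\frac{\phi(x+tu)-\phi(x)}{t}$. The dual continuation of a real-valued function $\phi$ on a real space $\mathcal{X}$ is $\tilde\phi(a+b\epsilon)=\phi(a)+\mathcal{D}_b\phi(a)\,\epsilon$ for $a,b\in\mathcal{X}$; the dual continuation of a norm is denoted by the same symbol. $\mathrm{sym}(\boldsymbol{X})=\frac12(\boldsymbol{X}+\boldsymbol{X}^\top)$. The spectral norm of a real matrix is its largest singular value. *)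

theory Defs
  imports Complex_Main "Jordan_Normal_Form.Spectral_Radius"
begin

section \<open>Dual numbers\<close>

datatype dual = Dual (std_part: real) (inf_part: real)

instantiation dual :: comm_ring_1
begin

definition zero_dual :: dual where "0 = Dual 0 0"
definition one_dual :: dual where "1 = Dual 1 0"
definition plus_dual :: "dual \<Rightarrow> dual \<Rightarrow> dual" where
  "p + q = Dual (std_part p + std_part q) (inf_part p + inf_part q)"
definition uminus_dual :: "dual \<Rightarrow> dual" where
  "- p = Dual (- std_part p) (- inf_part p)"
definition minus_dual :: "dual \<Rightarrow> dual \<Rightarrow> dual" where
  "p - q = Dual (std_part p - std_part q) (inf_part p - inf_part q)"
definition times_dual :: "dual \<Rightarrow> dual \<Rightarrow> dual" where
  "p * q = Dual (std_part p * std_part q) (std_part p * inf_part q + inf_part p * std_part q)"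

instance
  by standard
    (auto simp: zero_dual_def one_dual_def plus_dual_def uminus_dual_def minus_dual_def
      times_dual_def algebra_simps)

end

instantiation dual :: real_algebra_1
begin

definition scaleR_dual :: "real \<Rightarrow> dual \<Rightarrow> dual" where
  "c *\<^sub>R p = Dual (c * std_part p) (c * inf_part p)"

instance
  by standard (auto simp: scaleR_dual_def one_dual_def plus_dual_def times_dual_def algebra_simps)

end

definition dual_eps :: dual where "dual_eps = Dual 0 1"

lemma dual_eps_neq_0: "dual_eps \<noteq> 0"
  by (simp add: dual_eps_def zero_dual_def)

lemma dual_eps_square: "dual_eps * dual_eps = 0"
  by (simp add: dual_eps_def zero_dual_def times_dual_def)

lemma of_real_dual: "of_real x = Dual x 0"
  by (simp add: of_real_def scaleR_dual_def one_dual_def)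

lemma dual_decomp: "p = of_real (std_part p) + of_real (inf_part p) * dual_eps"
  by (cases p) (simp add: of_real_dual dual_eps_def plus_dual_def times_dual_def)

section \<open>Dual matrices\<close>

definition std_mat :: "dual mat \<Rightarrow> real mat" where "std_mat A = map_mat std_part A"

definition inf_mat :: "dual mat \<Rightarrow> real mat" where "inf_mat A = map_mat inf_part A"

lemma dual_mat_decomp:
  "A = map_mat of_real (std_mat A) + dual_eps \<cdot>\<^sub>m map_mat of_real (inf_mat A)"
proof (rule eq_matI)
  have "p = of_real (std_part p) + dual_eps * of_real (inf_part p)" for p
    using dual_decomp[of p] by (simp add: mult.commute)
  then show "A $$ (i, j) =
      (map_mat of_real (std_mat A) + dual_eps \<cdot>\<^sub>m map_mat of_real (inf_mat A)) $$ (i, j)"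
    if "i < dim_row (map_mat of_real (std_mat A) + dual_eps \<cdot>\<^sub>m map_mat of_real (inf_mat A))"
      and "j < dim_col (map_mat of_real (std_mat A) + dual_eps \<cdot>\<^sub>m map_mat of_real (inf_mat A))"
    for i j
    using that by (simp add: std_mat_def inf_mat_def)
qed (simp_all add: std_mat_def inf_mat_def)

definition gateaux :: "(real mat \<Rightarrow> real) \<Rightarrow> real mat \<Rightarrow> real mat \<Rightarrow> real" where
  "gateaux \<phi> D X = Lim (at_right 0) (\<lambda>t. (\<phi> (X + t \<cdot>\<^sub>m D) - \<phi> X) / t)"

definition dual_continuation :: "(real mat \<Rightarrow> real) \<Rightarrow> dual mat \<Rightarrow> dual" where
  "dual_continuation \<phi> A =
     of_real (\<phi> (std_mat A)) + of_real (gateaux \<phi> (inf_mat A) (std_mat A)) * dual_eps"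

section \<open>Singular values\<close>

(* For dim_row A < dim_col A this set also contains 0, which does not affect its maximum. *)
definition singular_values :: "real mat \<Rightarrow> real set" where
  "singular_values A = sqrt ` spectrum (A\<^sup>T * A)"

definition spectral_norm :: "real mat \<Rightarrow> real" where
  "spectral_norm A = Max (singular_values A)"

(* A = U S V^T with U, V orthogonal, and the diagonal of S nonnegative and nonincreasing. *)
definition full_svd :: "real mat \<Rightarrow> real mat \<Rightarrow> real mat \<Rightarrow> real mat \<Rightarrow> bool" where
  "full_svd A U S V \<longleftrightarrow>
     U \<in> carrier_mat (dim_row A) (dim_row A) \<and> U\<^sup>T * U = 1\<^sub>m (dim_row A) \<and>
     V \<in> carrier_mat (dim_col A) (dim_col A) \<and> V\<^sup>T * V = 1\<^sub>m (dim_col A) \<and>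
     S \<in> carrier_mat (dim_row A) (dim_col A) \<and> diagonal_mat S \<and>
     (\<forall>i < min (dim_row A) (dim_col A). 0 \<le> S $$ (i, i)) \<and>
     (\<forall>i j. i \<le> j \<and> j < min (dim_row A) (dim_col A) \<longrightarrow> S $$ (j, j) \<le> S $$ (i, i)) \<and>
     A = U * S * V\<^sup>T"

definition sv_multiplicity :: "real mat \<Rightarrow> real \<Rightarrow> nat" where
  "sv_multiplicity S s = card {i. i < min (dim_row S) (dim_col S) \<and> S $$ (i, i) = s}"

(* In a full SVD the singular values are sorted, so the singular vectors of the largest one,
   of multiplicity r, are the first r columns of U and of V. *)
definition first_cols :: "nat \<Rightarrow> real mat \<Rightarrow> real mat" where
  "first_cols r M = mat_of_cols (dim_row M) (take r (cols M))"

definition sym_part :: "real mat \<Rightarrow> real mat" where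
  "sym_part X = (1 / 2) \<cdot>\<^sub>m (X + X\<^sup>T)"

definition lambda_max :: "real mat \<Rightarrow> real" where
  "lambda_max R = Max (spectrum R)"

end

theory Submission
  imports Defs
begin

text \<open>The infinitesimal part of the dual norm is the one-sided derivative of the spectral norm at the
standard part \<open>X\<close> in the direction \<open>D\<close> of the infinitesimal part.  The spectral norm is the maximum
of the bilinear form \<open>y \<bullet> X x\<close> over pairs of unit vectors (\<open>spectral_norm_bound\<close>,
\<open>spectral_norm_attained\<close>), and as a maximum of functions that are linear in \<open>X\<close> it has as its
derivative the maximum of \<open>y \<bullet> D x\<close> over those pairs that are optimal for \<open>X\<close>.  If \<open>X\<close> is not
zero, the optimal pairs are \<open>x = V\<^sub>1 c\<close>, \<open>y = U\<^sub>1 c\<close> with a unit vector \<open>c\<close>, where \<open>U\<^sub>1\<close> and \<open>V\<^sub>1\<close>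
hold the singular vectors for the largest singular value.  For them
\<open>y \<bullet> D x = c \<bullet> (U\<^sub>1\<^sup>T D V\<^sub>1) c = c \<bullet> R c\<close>, and the maximum of this over \<open>c\<close> is the largest eigenvalue
of the symmetric matrix \<open>R\<close> (\<open>Rayleigh_lambda_max\<close>).

The general principle on derivatives of maxima is replaced by two explicit bounds.  An optimal pair
for \<open>X\<close> that also maximizes \<open>y \<bullet> D x\<close> shows that the norm of \<open>X + t D\<close> is at least its first-order
expansion (\<open>spectral_norm_perturbed_ge\<close>).  Conversely the gap between the largest singular value and
the others makes the form of \<open>X\<close> fall off quadratically away from the optimal pairs
(\<open>diagonal_form_gap\<close>), while the form of \<open>D\<close> changes at most linearly; so the first-order expansion
is exceeded by at most a multiple of \<open>t\<^sup>2\<close> (\<open>spectral_norm_perturbed_le\<close>).  The difference quotient is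
squeezed between the largest eigenvalue of \<open>R\<close> and a function tending to it.  At the zero matrix
every pair is optimal, and positive homogeneity gives the derivative at once.\<close>

section \<open>Euclidean vectors and compactness of the unit sphere\<close>

lemma scalar_prod_self_nonneg: "0 \<le> (x :: real vec) \<bullet> x"
  by (simp add: scalar_prod_def sum_nonneg)

lemma scalar_prod_self_eq_0_iff:
  fixes x :: "real vec"
  assumes "x \<in> carrier_vec n"
  shows "x \<bullet> x = 0 \<longleftrightarrow> x = 0\<^sub>v n"
  using assms by (auto simp: scalar_prod_def sum_nonneg_eq_0_iff)

lemma Cauchy_Schwarz_vec:
  fixes x y :: "real vec"
  assumes x: "x \<in> carrier_vec n" and y: "y \<in> carrier_vec n"
  shows "x \<bullet> y \<le> sqrt (x \<bullet> x) * sqrt (y \<bullet> y)"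
proof (cases "x \<bullet> x = 0 \<or> y \<bullet> y = 0")
  case True
  then have "x = 0\<^sub>v n \<or> y = 0\<^sub>v n"
    using x y by (simp add: scalar_prod_self_eq_0_iff)
  then show ?thesis using x y by auto
next
  case False
  define a b where "a = sqrt (x \<bullet> x)" and "b = sqrt (y \<bullet> y)"
  have ab: "a > 0" "b > 0" "a\<^sup>2 = x \<bullet> x" "b\<^sup>2 = y \<bullet> y"
    using False scalar_prod_self_nonneg[of x] scalar_prod_self_nonneg[of y]
    by (auto simp: a_def b_def)
  have "0 \<le> (b \<cdot>\<^sub>v x - a \<cdot>\<^sub>v y) \<bullet> (b \<cdot>\<^sub>v x - a \<cdot>\<^sub>v y)"
    by (rule scalar_prod_self_nonneg)
  also have "\<dots> = b\<^sup>2 * (x \<bullet> x) + a\<^sup>2 * (y \<bullet> y) - 2 * a * b * (x \<bullet> y)"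
    using x y comm_scalar_prod[OF x y]
    by (simp add: minus_scalar_prod_distrib[of _ n] scalar_prod_minus_distrib[of _ n]
        power2_eq_square algebra_simps)
  also have "\<dots> = 2 * (a * b) * (a * b - x \<bullet> y)"
    unfolding ab(3,4)[symmetric] by (simp add: power2_eq_square algebra_simps)
  finally have "0 \<le> 2 * (a * b) * (a * b - x \<bullet> y)" .
  moreover have "0 < 2 * (a * b)" using ab(1,2) by simp
  ultimately have "x \<bullet> y \<le> a * b"
    using mult_pos_neg[of "2 * (a * b)" "a * b - x \<bullet> y"] by linarith
  then show ?thesis by (simp add: a_def b_def)
qed

lemma coordinate_square_le:
  fixes x :: "real vec"
  assumes "x \<in> carrier_vec n" and "i < n"
  shows "(x $ i)\<^sup>2 \<le> x \<bullet> x"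
proof -
  have "x $ i * x $ i \<le> (\<Sum>j\<in>{0..<n}. x $ j * x $ j)"
    using assms by (intro member_le_sum) auto
  then show ?thesis using assms by (simp add: scalar_prod_def power2_eq_square)
qed

text \<open>This is the compactness behind the existence of maximizers on the unit sphere.  One coordinate is
added at a time: each step thins out the previous subsequence, which keeps the limits already
obtained.\<close>

lemma coordinatewise_convergent_subseq:
  fixes f :: "nat \<Rightarrow> nat \<Rightarrow> real"
  assumes "\<And>k i. i < n \<Longrightarrow> \<bar>f k i\<bar> \<le> B"
  shows "\<exists>s l. strict_mono (s :: nat \<Rightarrow> nat) \<and> (\<forall>i<n. (\<lambda>k. f (s k) i) \<longlonglongrightarrow> l i)"
  using assms
proof (induction n)
  case 0
  show ?case by (auto intro!: exI[of _ id] strict_mono_id)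
next
  case (Suc n)
  then obtain s l where s: "strict_mono (s :: nat \<Rightarrow> nat)"
    and l: "\<And>i. i < n \<Longrightarrow> (\<lambda>k. f (s k) i) \<longlonglongrightarrow> l i"
    by (metis less_SucI)
  obtain g :: "nat \<Rightarrow> nat" where g: "strict_mono g" "monoseq (\<lambda>k. f (s (g k)) n)"
    using seq_monosub[of "\<lambda>k. f (s k) n"] by blast
  have "Bseq (\<lambda>k. f (s (g k)) n)"
    using Suc.prems[of n] by (intro BseqI'[of _ B]) simp
  then have "convergent (\<lambda>k. f (s (g k)) n)"
    using g(2) by (rule Bseq_monoseq_convergent)
  then obtain a where a: "(\<lambda>k. f (s (g k)) n) \<longlonglongrightarrow> a"
    unfolding convergent_def by blast
  have "(\<lambda>k. f ((s \<circ> g) k) i) \<longlonglongrightarrow> (l(n := a)) i" if "i < Suc n" for i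
  proof (cases "i = n")
    case True
    then show ?thesis using a by simp
  next
    case False
    then have "(\<lambda>k. f (s k) i) \<longlonglongrightarrow> l i" using l that by simp
    from LIMSEQ_subseq_LIMSEQ[OF this g(1)] show ?thesis
      using False by (simp add: o_def)
  qed
  then show ?case using strict_mono_o[OF s g(1)] by blast
qed

lemma bilinear_form_sum:
  fixes M :: "real mat"
  assumes "M \<in> carrier_mat m n" "x \<in> carrier_vec n" "y \<in> carrier_vec m"
  shows "y \<bullet> (M *\<^sub>v x) = (\<Sum>i<m. \<Sum>j<n. y $ i * (M $$ (i, j) * x $ j))"
  using assms
  by (simp add: scalar_prod_def sum_distrib_left lessThan_atLeast0)

text \<open>A maximizing sequence on the unit sphere has a coordinatewise convergent subsequence, and the norm
and the form are finite sums of products of coordinates, hence pass to the limit.\<close>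

lemma quadratic_form_attains_max:
  fixes M :: "real mat"
  assumes M: "M \<in> carrier_mat n n" and n: "1 \<le> n"
  obtains c where "c \<in> carrier_vec n" "c \<bullet> c = 1"
    "\<And>x. x \<in> carrier_vec n \<Longrightarrow> x \<bullet> x = 1 \<Longrightarrow> x \<bullet> (M *\<^sub>v x) \<le> c \<bullet> (M *\<^sub>v c)"
proof -
  define Q where "Q = (\<lambda>x. x \<bullet> (M *\<^sub>v x)) ` {x \<in> carrier_vec n. x \<bullet> x = 1}"
  have coord: "\<bar>x $ i\<bar> \<le> 1" if "x \<in> carrier_vec n" "x \<bullet> x = 1" "i < n" for x :: "real vec" and i
    using coordinate_square_le[OF that(1,3)] that(2) by (simp add: abs_square_le_1)
  have "unit_vec n 0 \<in> {x \<in> carrier_vec n. x \<bullet> x = (1::real)}"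
    using n by simp
  then have Qne: "Q \<noteq> {}" unfolding Q_def by blast
  have "x \<bullet> (M *\<^sub>v x) \<le> (\<Sum>i<n. \<Sum>j<n. \<bar>M $$ (i, j)\<bar>)"
    if x: "x \<in> carrier_vec n" "x \<bullet> x = 1" for x
    unfolding bilinear_form_sum[OF M x(1) x(1)]
  proof (intro sum_mono)
    fix i j assume ij: "i \<in> {..<n}" "j \<in> {..<n}"
    have "\<bar>x $ i * (M $$ (i, j) * x $ j)\<bar> = \<bar>M $$ (i, j)\<bar> * (\<bar>x $ i\<bar> * \<bar>x $ j\<bar>)"
      by (simp add: abs_mult)
    also have "\<dots> \<le> \<bar>M $$ (i, j)\<bar> * (1 * 1)"
      using coord[OF x] ij by (intro mult_left_mono mult_mono) auto
    finally show "x $ i * (M $$ (i, j) * x $ j) \<le> \<bar>M $$ (i, j)\<bar>" by simp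
  qed
  then have Qbdd: "bdd_above Q" unfolding Q_def by (auto intro!: bdd_aboveI)
  have "\<exists>x. x \<in> carrier_vec n \<and> x \<bullet> x = 1 \<and> Sup Q - 1 / Suc k < x \<bullet> (M *\<^sub>v x)" for k
    using less_cSup_iff[OF Qne Qbdd, of "Sup Q - 1 / Suc k"] unfolding Q_def by auto
  then obtain X where X: "\<And>k. X k \<in> carrier_vec n" "\<And>k. X k \<bullet> X k = 1"
    and XQ: "\<And>k. Sup Q - 1 / Suc k < X k \<bullet> (M *\<^sub>v X k)"
    by metis
  obtain s l where s: "strict_mono (s :: nat \<Rightarrow> nat)"
    and l: "\<And>i. i < n \<Longrightarrow> (\<lambda>k. X (s k) $ i) \<longlonglongrightarrow> l i"
    using coordinatewise_convergent_subseq[of n "\<lambda>k i. X k $ i" 1] coord[OF X] by blast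
  define c where "c = vec n l"
  have c: "c \<in> carrier_vec n" and ci: "\<And>i. i < n \<Longrightarrow> c $ i = l i"
    by (simp_all add: c_def)
  have dim: "dim_vec (X k) = n" "dim_vec c = n" for k using X(1)[of k] c by auto
  have "(\<lambda>k. X (s k) \<bullet> X (s k)) \<longlonglongrightarrow> c \<bullet> c"
    unfolding scalar_prod_def dim by (intro tendsto_sum tendsto_mult) (auto simp: ci l)
  then have c1: "c \<bullet> c = 1" unfolding X(2) by (simp add: LIMSEQ_const_iff)
  have lim: "(\<lambda>k. X (s k) \<bullet> (M *\<^sub>v X (s k))) \<longlonglongrightarrow> c \<bullet> (M *\<^sub>v c)"
    unfolding bilinear_form_sum[OF M X(1) X(1)] bilinear_form_sum[OF M c c]
    by (intro tendsto_sum tendsto_mult tendsto_const) (auto simp: ci l)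
  have "(\<lambda>k. Sup Q - 1 / Suc (s k)) \<longlonglongrightarrow> Sup Q - 0"
    using LIMSEQ_subseq_LIMSEQ[OF LIMSEQ_inverse_real_of_nat s]
    by (intro tendsto_diff tendsto_const) (simp add: o_def inverse_eq_divide)
  then have "Sup Q - 0 \<le> c \<bullet> (M *\<^sub>v c)"
    using lim XQ[of "s _", THEN less_imp_le] by (intro LIMSEQ_le) auto
  then have "x \<bullet> (M *\<^sub>v x) \<le> c \<bullet> (M *\<^sub>v c)" if "x \<in> carrier_vec n" "x \<bullet> x = 1" for x
    using cSup_upper[OF _ Qbdd, of "x \<bullet> (M *\<^sub>v x)"] that unfolding Q_def by force
  then show thesis using that c c1 by blast
qed

section \<open>The largest eigenvalue as a maximal Rayleigh quotient\<close>

lemma bilinear_form_smult: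
  fixes M :: "real mat"
  assumes "M \<in> carrier_mat m n" "x \<in> carrier_vec n" "y \<in> carrier_vec m"
  shows "(a \<cdot>\<^sub>v y) \<bullet> (M *\<^sub>v (b \<cdot>\<^sub>v x)) = a * b * (y \<bullet> (M *\<^sub>v x))"
  using assms by (simp add: mult_mat_vec[OF assms(1,2)])

text \<open>For small positive \<open>t\<close> the linear term dominates the quadratic one, so it has to vanish.\<close>

lemma perturbation_first_order:
  fixes a b :: real
  assumes a: "0 \<le> a" and le: "\<And>t. 2 * t * a + t\<^sup>2 * b \<le> 0"
  shows "a = 0"
proof (rule ccontr)
  assume "a \<noteq> 0"
  then have a: "a > 0" using a by simp
  define t where "t = a / (\<bar>b\<bar> + 1)"
  have t: "t > 0" unfolding t_def using a by (intro divide_pos_pos) auto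
  have "t * (\<bar>b\<bar> + 1) = a" unfolding t_def by simp
  have "t * \<bar>b\<bar> < 2 * a" using \<open>t * (\<bar>b\<bar> + 1) = a\<close> t a by (simp add: algebra_simps)
  moreover have "t * - b \<le> t * \<bar>b\<bar>" using t by (intro mult_left_mono) auto
  ultimately have "0 < 2 * a + t * b" by linarith
  then have "0 < t * (2 * a + t * b)" using t by simp
  then show False using le[of t] by (simp add: algebra_simps power2_eq_square)
qed

text \<open>Let \<open>c\<close> maximize the quadratic form on the unit sphere, with value \<open>l\<close>.  By homogeneity
\<open>x \<bullet> M x \<le> l (x \<bullet> x)\<close> for every \<open>x\<close>.  Moving \<open>c\<close> in the direction of the residual
\<open>w = M c - l c\<close> would increase the difference of the two sides at first order with rate
\<open>2 (w \<bullet> w)\<close>; hence \<open>w = 0\<close> and \<open>c\<close> is an eigenvector.  Every other eigenvalue is a Rayleigh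
quotient and so at most \<open>l\<close>.  In particular the real spectrum is nonempty, without which the maximum
that defines the largest eigenvalue would have no meaning.\<close>

theorem Rayleigh_lambda_max:
  fixes M :: "real mat"
  assumes M: "M \<in> carrier_mat n n" and sym: "M\<^sup>T = M" and n: "1 \<le> n"
  obtains c where "c \<in> carrier_vec n" "c \<bullet> c = 1" "eigenvector M c (lambda_max M)"
    "c \<bullet> (M *\<^sub>v c) = lambda_max M"
    "\<And>x. x \<in> carrier_vec n \<Longrightarrow> x \<bullet> (M *\<^sub>v x) \<le> lambda_max M * (x \<bullet> x)"
proof -
  obtain c where c: "c \<in> carrier_vec n" "c \<bullet> c = 1"
    and max: "\<And>x. x \<in> carrier_vec n \<Longrightarrow> x \<bullet> x = 1 \<Longrightarrow> x \<bullet> (M *\<^sub>v x) \<le> c \<bullet> (M *\<^sub>v c)"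
    using quadratic_form_attains_max[OF M n] by blast
  define l where "l = c \<bullet> (M *\<^sub>v c)"
  have le: "x \<bullet> (M *\<^sub>v x) \<le> l * (x \<bullet> x)" if x: "x \<in> carrier_vec n" for x
  proof (cases "x \<bullet> x = 0")
    case True
    then show ?thesis using x M by (simp add: scalar_prod_self_eq_0_iff[OF x])
  next
    case False
    then have pos: "0 < x \<bullet> x" using scalar_prod_self_nonneg[of x] by simp
    define a where "a = 1 / sqrt (x \<bullet> x)"
    have aa: "a * a * (x \<bullet> x) = 1" using pos by (simp add: a_def)
    have "(a \<cdot>\<^sub>v x) \<bullet> (M *\<^sub>v (a \<cdot>\<^sub>v x)) \<le> l"
      unfolding l_def using x aa by (intro max) auto
    then have "a * a * (x \<bullet> (M *\<^sub>v x)) \<le> l" by (simp add: bilinear_form_smult[OF M x x])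
    then have "(x \<bullet> x) * (a * a * (x \<bullet> (M *\<^sub>v x))) \<le> (x \<bullet> x) * l"
      using pos by (intro mult_left_mono) auto
    then show ?thesis using pos by (simp add: a_def mult.commute)
  qed
  define w where "w = M *\<^sub>v c - l \<cdot>\<^sub>v c"
  have Mc: "M *\<^sub>v c \<in> carrier_vec n" using M c by simp
  have w: "w \<in> carrier_vec n" unfolding w_def using Mc c by simp
  have Mw: "M *\<^sub>v w \<in> carrier_vec n" using M w by simp
  have cMw: "c \<bullet> (M *\<^sub>v w) = w \<bullet> (M *\<^sub>v c)"
    using transpose_vec_mult_scalar[OF M w c(1)] unfolding sym
    using comm_scalar_prod[OF Mc w] comm_scalar_prod[OF c(1) Mw] by simp
  have ww: "w \<bullet> w = w \<bullet> (M *\<^sub>v c) - l * (w \<bullet> c)"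
    using w Mc c by (subst (2) w_def) (simp add: scalar_prod_minus_distrib[OF w Mc])
  \<comment> \<open>The inequality \<open>le\<close> at \<open>c + t w\<close>; the terms of order zero cancel.\<close>
  have "2 * t * (w \<bullet> w) + t\<^sup>2 * (w \<bullet> (M *\<^sub>v w) - l * (w \<bullet> w)) \<le> 0" for t
  proof -
    define x where "x = c + t \<cdot>\<^sub>v w"
    have x: "x \<in> carrier_vec n" unfolding x_def using c w by simp
    have Mx: "M *\<^sub>v x = M *\<^sub>v c + t \<cdot>\<^sub>v (M *\<^sub>v w)"
      unfolding x_def using M c w by (simp add: mult_add_distrib_mat_vec[OF M] mult_mat_vec[OF M])
    have "x \<bullet> (M *\<^sub>v x) = l + 2 * t * (w \<bullet> (M *\<^sub>v c)) + t\<^sup>2 * (w \<bullet> (M *\<^sub>v w))"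
      unfolding Mx unfolding x_def using c w Mc Mw
      by (simp add: add_scalar_prod_distrib[of _ n] scalar_prod_add_distrib[of _ n] cMw
          l_def[symmetric] power2_eq_square algebra_simps)
    moreover have "x \<bullet> x = 1 + 2 * t * (w \<bullet> c) + t\<^sup>2 * (w \<bullet> w)"
      unfolding x_def using c w comm_scalar_prod[OF c(1) w]
      by (simp add: add_scalar_prod_distrib[of _ n] scalar_prod_add_distrib[of _ n]
          power2_eq_square algebra_simps)
    moreover have "t * (w \<bullet> w) = t * (w \<bullet> (M *\<^sub>v c)) - l * (t * (w \<bullet> c))"
      unfolding ww by (simp add: algebra_simps)
    ultimately show ?thesis using le[OF x] by (simp add: algebra_simps)
  qed
  from perturbation_first_order[OF scalar_prod_self_nonneg this] have "w = 0\<^sub>v n"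
    using scalar_prod_self_eq_0_iff[OF w] by simp
  have "M *\<^sub>v c = l \<cdot>\<^sub>v c"
  proof (rule eq_vecI)
    fix i assume "i < dim_vec (l \<cdot>\<^sub>v c)"
    then have i: "i < n" using c by simp
    have "w $ i = 0" using \<open>w = 0\<^sub>v n\<close> i by simp
    then show "(M *\<^sub>v c) $ i = (l \<cdot>\<^sub>v c) $ i" unfolding w_def using i c Mc M by simp
  qed (use M c in auto)
  moreover have "c \<noteq> 0\<^sub>v n" using c by auto
  ultimately have ev: "eigenvector M c l" unfolding eigenvector_def using c M by simp
  have "k \<le> l" if k: "k \<in> spectrum M" for k
  proof -
    obtain v where v: "v \<in> carrier_vec n" "v \<noteq> 0\<^sub>v n" "M *\<^sub>v v = k \<cdot>\<^sub>v v"
      using k M unfolding spectrum_def eigenvalue_def eigenvector_def by auto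
    have "k * (v \<bullet> v) \<le> l * (v \<bullet> v)" using le[OF v(1)] v by simp
    moreover have "0 < v \<bullet> v"
      using scalar_prod_self_nonneg[of v] scalar_prod_self_eq_0_iff[OF v(1)] v(2) by simp
    ultimately show ?thesis by simp
  qed
  moreover have "l \<in> spectrum M" using ev unfolding spectrum_def eigenvalue_def by blast
  ultimately have "lambda_max M = l"
    unfolding lambda_max_def using card_finite_spectrum(1)[OF M] by (intro Max_eqI) auto
  then show thesis using that c ev le l_def by simp
qed

section \<open>Variational description of the spectral norm\<close>

lemma Gram_mat_scalar_prod:
  fixes X :: "real mat"
  assumes X: "X \<in> carrier_mat m n" and x: "x \<in> carrier_vec n"
  shows "x \<bullet> ((X\<^sup>T * X) *\<^sub>v x) = (X *\<^sub>v x) \<bullet> (X *\<^sub>v x)"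
proof -
  have Xx: "X *\<^sub>v x \<in> carrier_vec m" using X x by simp
  have "x \<bullet> ((X\<^sup>T * X) *\<^sub>v x) = x \<bullet> (X\<^sup>T *\<^sub>v (X *\<^sub>v x))"
    using X x by (subst assoc_mult_mat_vec[of _ n m _ n]) auto
  also have "\<dots> = (X\<^sup>T *\<^sub>v (X *\<^sub>v x)) \<bullet> x"
    using X Xx x by (intro comm_scalar_prod) auto
  also have "\<dots> = (X *\<^sub>v x) \<bullet> (X *\<^sub>v x)" by (rule transpose_vec_mult_scalar[OF X x Xx])
  finally show ?thesis .
qed

text \<open>The Rayleigh principle for the Gram matrix \<open>X\<^sup>T X\<close>: the square root is monotone, so the largest
singular value is the square root of the largest eigenvalue, and the quadratic form of the Gram
matrix is the squared length of \<open>X x\<close>.\<close>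

lemma spectral_norm_maximizer:
  fixes X :: "real mat"
  assumes X: "X \<in> carrier_mat m n" and n: "1 \<le> n"
  obtains c where "c \<in> carrier_vec n" "c \<bullet> c = 1"
    "(X *\<^sub>v c) \<bullet> (X *\<^sub>v c) = (spectral_norm X)\<^sup>2"
    "\<And>x. x \<in> carrier_vec n \<Longrightarrow> (X *\<^sub>v x) \<bullet> (X *\<^sub>v x) \<le> (spectral_norm X)\<^sup>2 * (x \<bullet> x)"
    "0 \<le> spectral_norm X"
proof -
  have M: "X\<^sup>T * X \<in> carrier_mat n n" using X by simp
  have "(X\<^sup>T * X)\<^sup>T = X\<^sup>T * X"
    using X by (simp add: transpose_mult[of _ n m _ n])
  then obtain c where c: "c \<in> carrier_vec n" "c \<bullet> c = 1"
    and ev: "eigenvector (X\<^sup>T * X) c (lambda_max (X\<^sup>T * X))"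
    and max: "c \<bullet> ((X\<^sup>T * X) *\<^sub>v c) = lambda_max (X\<^sup>T * X)"
    and le: "\<And>x. x \<in> carrier_vec n \<Longrightarrow>
      x \<bullet> ((X\<^sup>T * X) *\<^sub>v x) \<le> lambda_max (X\<^sup>T * X) * (x \<bullet> x)"
    using Rayleigh_lambda_max[OF M _ n] by blast
  have fin: "finite (spectrum (X\<^sup>T * X))" by (rule card_finite_spectrum(1)[OF M])
  have ne: "spectrum (X\<^sup>T * X) \<noteq> {}" using ev unfolding spectrum_def eigenvalue_def by blast
  have "mono sqrt" by (simp add: mono_def)
  from mono_Max_commute[OF this fin ne]
  have f: "spectral_norm X = sqrt (lambda_max (X\<^sup>T * X))"
    unfolding spectral_norm_def singular_values_def lambda_max_def by simp
  have l0: "0 \<le> lambda_max (X\<^sup>T * X)"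
    using max Gram_mat_scalar_prod[OF X c(1)] scalar_prod_self_nonneg[of "X *\<^sub>v c"] by simp
  have ff: "(spectral_norm X)\<^sup>2 = lambda_max (X\<^sup>T * X)" using l0 f by simp
  show thesis
  proof (rule that[OF c])
    show "(X *\<^sub>v c) \<bullet> (X *\<^sub>v c) = (spectral_norm X)\<^sup>2"
      unfolding ff using max Gram_mat_scalar_prod[OF X c(1)] by simp
    show "(X *\<^sub>v x) \<bullet> (X *\<^sub>v x) \<le> (spectral_norm X)\<^sup>2 * (x \<bullet> x)"
      if "x \<in> carrier_vec n" for x
      unfolding ff using le[OF that] Gram_mat_scalar_prod[OF X that] by simp
    show "0 \<le> spectral_norm X" using f l0 by simp
  qed
qed

lemma spectral_norm_nonneg:
  assumes "X \<in> carrier_mat m n" and "1 \<le> n"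
  shows "0 \<le> spectral_norm X"
  using spectral_norm_maximizer[OF assms] by blast

text \<open>Together with the next lemma, this says that the spectral norm is the maximum of \<open>y \<bullet> X x\<close> over
pairs of unit vectors.  All later arguments use this description; it is linear in \<open>X\<close>, which is
what makes perturbations tractable.\<close>

lemma spectral_norm_bound:
  fixes X :: "real mat"
  assumes X: "X \<in> carrier_mat m n" and n: "1 \<le> n"
    and x: "x \<in> carrier_vec n" and y: "y \<in> carrier_vec m"
  shows "y \<bullet> (X *\<^sub>v x) \<le> spectral_norm X * (sqrt (y \<bullet> y) * sqrt (x \<bullet> x))"
proof -
  have "(X *\<^sub>v x) \<bullet> (X *\<^sub>v x) \<le> (spectral_norm X)\<^sup>2 * (x \<bullet> x)"
    using spectral_norm_maximizer[OF X n] x by blast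
  from real_sqrt_le_mono[OF this]
  have "sqrt ((X *\<^sub>v x) \<bullet> (X *\<^sub>v x)) \<le> spectral_norm X * sqrt (x \<bullet> x)"
    using spectral_norm_nonneg[OF X n] by (simp add: real_sqrt_mult)
  then have "sqrt (y \<bullet> y) * sqrt ((X *\<^sub>v x) \<bullet> (X *\<^sub>v x)) \<le>
      sqrt (y \<bullet> y) * (spectral_norm X * sqrt (x \<bullet> x))"
    by (intro mult_left_mono) (simp_all add: scalar_prod_self_nonneg)
  moreover have "y \<bullet> (X *\<^sub>v x) \<le> sqrt (y \<bullet> y) * sqrt ((X *\<^sub>v x) \<bullet> (X *\<^sub>v x))"
    using X x by (intro Cauchy_Schwarz_vec[OF y]) simp
  ultimately show ?thesis by (simp add: algebra_simps)
qed

lemma spectral_norm_attained: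
  fixes X :: "real mat"
  assumes X: "X \<in> carrier_mat m n" and n: "1 \<le> n" and m: "1 \<le> m"
  obtains x y where "x \<in> carrier_vec n" "x \<bullet> x = 1" "y \<in> carrier_vec m" "y \<bullet> y = 1"
    "y \<bullet> (X *\<^sub>v x) = spectral_norm X"
proof -
  obtain x where x: "x \<in> carrier_vec n" "x \<bullet> x = 1"
    and max: "(X *\<^sub>v x) \<bullet> (X *\<^sub>v x) = (spectral_norm X)\<^sup>2"
    using spectral_norm_maximizer[OF X n] by blast
  have Xx: "X *\<^sub>v x \<in> carrier_vec m" using X x by simp
  show thesis
  proof (cases "spectral_norm X = 0")
    case True
    then have "X *\<^sub>v x = 0\<^sub>v m" using max scalar_prod_self_eq_0_iff[OF Xx] by simp
    \<comment> \<open>Here \<open>X x = 0\<close>, so any unit vector serves as \<open>y\<close>.\<close>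
    then show thesis using True m by (intro that[OF x, of "unit_vec m 0"]) auto
  next
    case False
    define y where "y = (1 / spectral_norm X) \<cdot>\<^sub>v (X *\<^sub>v x)"
    have "y \<bullet> y = 1" "y \<bullet> (X *\<^sub>v x) = spectral_norm X"
      unfolding y_def using Xx max False by (simp_all add: power2_eq_square)
    then show thesis using Xx by (intro that[OF x, of y]) (simp_all add: y_def)
  qed
qed

lemma spectral_norm_le_iff:
  fixes X :: "real mat"
  assumes X: "X \<in> carrier_mat m n" and n: "1 \<le> n" and m: "1 \<le> m"
  shows "spectral_norm X \<le> b \<longleftrightarrow>
    (\<forall>x\<in>carrier_vec n. \<forall>y\<in>carrier_vec m. x \<bullet> x = 1 \<longrightarrow> y \<bullet> y = 1 \<longrightarrow> y \<bullet> (X *\<^sub>v x) \<le> b)"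
proof
  assume le: "spectral_norm X \<le> b"
  show "\<forall>x\<in>carrier_vec n. \<forall>y\<in>carrier_vec m. x \<bullet> x = 1 \<longrightarrow> y \<bullet> y = 1 \<longrightarrow> y \<bullet> (X *\<^sub>v x) \<le> b"
  proof (intro ballI impI)
    fix x y :: "real vec"
    assume "x \<in> carrier_vec n" "y \<in> carrier_vec m" "x \<bullet> x = 1" "y \<bullet> y = 1"
    then show "y \<bullet> (X *\<^sub>v x) \<le> b"
      using spectral_norm_bound[OF X n, of x y] le by simp
  qed
next
  assume "\<forall>x\<in>carrier_vec n. \<forall>y\<in>carrier_vec m. x \<bullet> x = 1 \<longrightarrow> y \<bullet> y = 1 \<longrightarrow> y \<bullet> (X *\<^sub>v x) \<le> b"
  then show "spectral_norm X \<le> b"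
    using spectral_norm_attained[OF X n m] by metis
qed

lemma smult_mat_scalar_prod:
  fixes D :: "real mat"
  assumes "D \<in> carrier_mat m n" "x \<in> carrier_vec n" "y \<in> carrier_vec m"
  shows "y \<bullet> ((t \<cdot>\<^sub>m D) *\<^sub>v x) = t * (y \<bullet> (D *\<^sub>v x))"
proof -
  have "(t \<cdot>\<^sub>m D) *\<^sub>v x = t \<cdot>\<^sub>v (D *\<^sub>v x)" using assms by (intro eq_vecI) auto
  then show ?thesis using assms by simp
qed

lemma perturbed_mat_scalar_prod:
  fixes X D :: "real mat"
  assumes X: "X \<in> carrier_mat m n" and D: "D \<in> carrier_mat m n"
    and x: "x \<in> carrier_vec n" and y: "y \<in> carrier_vec m"
  shows "y \<bullet> ((X + t \<cdot>\<^sub>m D) *\<^sub>v x) = y \<bullet> (X *\<^sub>v x) + t * (y \<bullet> (D *\<^sub>v x))"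
proof -
  have "y \<bullet> ((X + t \<cdot>\<^sub>m D) *\<^sub>v x) = y \<bullet> (X *\<^sub>v x + (t \<cdot>\<^sub>m D) *\<^sub>v x)"
    using D by (subst add_mult_distrib_mat_vec[OF X _ x]) auto
  also have "\<dots> = y \<bullet> (X *\<^sub>v x) + y \<bullet> ((t \<cdot>\<^sub>m D) *\<^sub>v x)"
    using X D x y by (intro scalar_prod_add_distrib[of _ m] mult_mat_vec_carrier[of _ m n]) auto
  finally show ?thesis using smult_mat_scalar_prod[OF D x y] by simp
qed

lemma spectral_norm_smult:
  fixes D :: "real mat"
  assumes D: "D \<in> carrier_mat m n" and n: "1 \<le> n" and m: "1 \<le> m" and t: "0 \<le> t"
  shows "spectral_norm (t \<cdot>\<^sub>m D) = t * spectral_norm D"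
proof (rule antisym)
  have tD: "t \<cdot>\<^sub>m D \<in> carrier_mat m n" using D by simp
  obtain x y where xy: "x \<in> carrier_vec n" "x \<bullet> x = 1" "y \<in> carrier_vec m" "y \<bullet> y = 1"
    and att: "y \<bullet> (D *\<^sub>v x) = spectral_norm D"
    using spectral_norm_attained[OF D n m] by blast
  then have "y \<bullet> ((t \<cdot>\<^sub>m D) *\<^sub>v x) = t * spectral_norm D"
    by (simp add: smult_mat_scalar_prod[OF D])
  then show "t * spectral_norm D \<le> spectral_norm (t \<cdot>\<^sub>m D)"
    using spectral_norm_bound[OF tD n xy(1,3)] xy by simp
  show "spectral_norm (t \<cdot>\<^sub>m D) \<le> t * spectral_norm D"
    unfolding spectral_norm_le_iff[OF tD n m]
  proof (intro ballI impI)
    fix x y :: "real vec"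
    assume xy: "x \<in> carrier_vec n" "y \<in> carrier_vec m" "x \<bullet> x = 1" "y \<bullet> y = 1"
    then show "y \<bullet> ((t \<cdot>\<^sub>m D) *\<^sub>v x) \<le> t * spectral_norm D"
      using spectral_norm_bound[OF D n xy(1,2)] t
      by (simp add: smult_mat_scalar_prod[OF D] mult_left_mono)
  qed
qed

text \<open>By positive homogeneity the difference quotient at the zero matrix is constant.\<close>

lemma gateaux_spectral_norm_0:
  assumes D: "D \<in> carrier_mat m n" and n: "1 \<le> n" and m: "1 \<le> m"
  shows "spectral_norm (0\<^sub>m m n) = 0" and "gateaux spectral_norm D (0\<^sub>m m n) = spectral_norm D"
proof -
  have "0\<^sub>m m n = 0 \<cdot>\<^sub>m D" using D by (intro eq_matI) auto
  with spectral_norm_smult[OF D n m, of 0] show f0: "spectral_norm (0\<^sub>m m n) = 0" by simp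
  have "(spectral_norm (0\<^sub>m m n + t \<cdot>\<^sub>m D) - spectral_norm (0\<^sub>m m n)) / t = spectral_norm D"
    if "0 < t" for t
  proof -
    have "0\<^sub>m m n + t \<cdot>\<^sub>m D = t \<cdot>\<^sub>m D" using D by simp
    then show ?thesis using spectral_norm_smult[OF D n m, of t] that f0 by simp
  qed
  then have "\<forall>\<^sub>F t in at_right 0. spectral_norm D =
      (spectral_norm (0\<^sub>m m n + t \<cdot>\<^sub>m D) - spectral_norm (0\<^sub>m m n)) / t"
    by (intro eventually_at_rightI[of 0 1]) auto
  from Lim_transform_eventually[OF tendsto_const this]
  show "gateaux spectral_norm D (0\<^sub>m m n) = spectral_norm D"
    unfolding gateaux_def by (intro tendsto_Lim) auto
qed

section \<open>Orthogonal changes of basis, truncation and diagonal forms\<close>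

lemma orthogonal_mat_mult_transpose:
  fixes U :: "real mat"
  assumes "U \<in> carrier_mat k k" "U\<^sup>T * U = 1\<^sub>m k"
  shows "U * U\<^sup>T = 1\<^sub>m k"
  using mat_mult_left_right_inverse[of "U\<^sup>T" k U] assms by simp

lemma orthogonal_mat_scalar_prod:
  fixes U :: "real mat"
  assumes U: "U \<in> carrier_mat k k" "U\<^sup>T * U = 1\<^sub>m k"
    and x: "x \<in> carrier_vec k" and y: "y \<in> carrier_vec k"
  shows "(U *\<^sub>v y) \<bullet> (U *\<^sub>v x) = y \<bullet> x" and "(U\<^sup>T *\<^sub>v y) \<bullet> (U\<^sup>T *\<^sub>v x) = y \<bullet> x"
proof -
  have *: "(W *\<^sub>v y) \<bullet> (W *\<^sub>v x) = y \<bullet> x"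
    if W: "W \<in> carrier_mat k k" "W\<^sup>T * W = 1\<^sub>m k" for W :: "real mat"
  proof -
    have Wx: "W *\<^sub>v x \<in> carrier_vec k" and Wy: "W *\<^sub>v y \<in> carrier_vec k" using W x y by auto
    have "(W\<^sup>T *\<^sub>v (W *\<^sub>v y)) \<bullet> x = (W *\<^sub>v y) \<bullet> (W *\<^sub>v x)"
      by (rule transpose_vec_mult_scalar[OF W(1) x Wy])
    moreover have "W\<^sup>T *\<^sub>v (W *\<^sub>v y) = (W\<^sup>T * W) *\<^sub>v y"
      using W y by (intro assoc_mult_mat_vec[symmetric, of _ k k _ k]) auto
    ultimately show ?thesis using W y by simp
  qed
  show "(U *\<^sub>v y) \<bullet> (U *\<^sub>v x) = y \<bullet> x" by (rule *[OF U])
  show "(U\<^sup>T *\<^sub>v y) \<bullet> (U\<^sup>T *\<^sub>v x) = y \<bullet> x"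
    using U orthogonal_mat_mult_transpose[OF U] by (intro *) auto
qed

lemma orthogonal_mat_cancel:
  fixes U :: "real mat"
  assumes U: "U \<in> carrier_mat k k" "U\<^sup>T * U = 1\<^sub>m k" and y: "y \<in> carrier_vec k"
  shows "U *\<^sub>v (U\<^sup>T *\<^sub>v y) = y"
  using assoc_mult_mat_vec[of U k k "U\<^sup>T" k y] orthogonal_mat_mult_transpose[OF U] U y by simp

lemma bilinear_change_basis:
  fixes X U V :: "real mat"
  assumes X: "X \<in> carrier_mat m n" and U: "U \<in> carrier_mat m k" and V: "V \<in> carrier_mat n l"
    and p: "p \<in> carrier_vec l" and q: "q \<in> carrier_vec k"
  shows "q \<bullet> ((U\<^sup>T * X * V) *\<^sub>v p) = (U *\<^sub>v q) \<bullet> (X *\<^sub>v (V *\<^sub>v p))"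
proof -
  have Vp: "V *\<^sub>v p \<in> carrier_vec n" using V p by auto
  have z: "X *\<^sub>v (V *\<^sub>v p) \<in> carrier_vec m" using X Vp by auto
  have Uz: "U\<^sup>T *\<^sub>v (X *\<^sub>v (V *\<^sub>v p)) \<in> carrier_vec k" using U z by auto
  have Uq: "U *\<^sub>v q \<in> carrier_vec m" using U q by auto
  have UX: "U\<^sup>T * X \<in> carrier_mat k n" using U X by auto
  have "(U\<^sup>T * X * V) *\<^sub>v p = U\<^sup>T *\<^sub>v (X *\<^sub>v (V *\<^sub>v p))"
    using assoc_mult_mat_vec[OF UX V p] assoc_mult_mat_vec[of "U\<^sup>T" k m X n, OF _ X Vp] U by simp
  then have "q \<bullet> ((U\<^sup>T * X * V) *\<^sub>v p) = (U\<^sup>T *\<^sub>v (X *\<^sub>v (V *\<^sub>v p))) \<bullet> q"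
    using comm_scalar_prod[OF q Uz] by simp
  also have "\<dots> = (X *\<^sub>v (V *\<^sub>v p)) \<bullet> (U *\<^sub>v q)" by (rule transpose_vec_mult_scalar[OF U q z])
  also have "\<dots> = (U *\<^sub>v q) \<bullet> (X *\<^sub>v (V *\<^sub>v p))" by (rule comm_scalar_prod[OF z Uq])
  finally show ?thesis .
qed

text \<open>Multiplying the first \<open>r\<close> columns of a matrix by a vector is multiplying the whole matrix by the
vector extended by zeros, so that no block decomposition is needed.\<close>

definition zero_pad :: "nat \<Rightarrow> real vec \<Rightarrow> real vec" where
  "zero_pad k c = vec k (\<lambda>i. if i < dim_vec c then c $ i else 0)"

lemma zero_pad_carrier[simp]: "zero_pad k c \<in> carrier_vec k"
  by (simp add: zero_pad_def)

lemma sum_extend_zero: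
  fixes g :: "nat \<Rightarrow> real"
  assumes "n \<le> m"
  shows "(\<Sum>i<n. g i) = (\<Sum>i<m. if i < n then g i else 0)"
proof -
  have "{..<m} \<inter> {i. i < n} = {..<n}" using assms by auto
  then show ?thesis by (simp add: sum.If_cases)
qed

lemma zero_pad_scalar_prod_self:
  assumes c: "c \<in> carrier_vec r" and r: "r \<le> k"
  shows "zero_pad k c \<bullet> zero_pad k c = c \<bullet> c"
proof -
  have "c \<bullet> c = (\<Sum>i<k. if i < r then c $ i * c $ i else 0)"
    using c sum_extend_zero[OF r, of "\<lambda>i. c $ i * c $ i"]
    by (simp add: scalar_prod_def lessThan_atLeast0)
  also have "\<dots> = zero_pad k c \<bullet> zero_pad k c"
    using c by (auto simp: scalar_prod_def zero_pad_def lessThan_atLeast0 intro!: sum.cong)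
  finally show ?thesis by simp
qed

lemma first_cols_carrier:
  assumes "U \<in> carrier_mat m k" and "r \<le> k"
  shows "first_cols r U \<in> carrier_mat m r"
  using assms unfolding first_cols_def carrier_mat_def by (simp add: min_def)

lemma first_cols_mult_vec:
  fixes U :: "real mat"
  assumes U: "U \<in> carrier_mat m k" and r: "r \<le> k" and c: "c \<in> carrier_vec r"
  shows "first_cols r U *\<^sub>v c = U *\<^sub>v zero_pad k c"
proof (rule eq_vecI)
  fix i assume "i < dim_vec (U *\<^sub>v zero_pad k c)"
  then have i: "i < m" using U by simp
  have F: "first_cols r U \<in> carrier_mat m r" by (rule first_cols_carrier[OF U r])
  have entry: "first_cols r U $$ (i, j) = U $$ (i, j)" if "j < r" for j
    using that i U r unfolding first_cols_def by (subst mat_of_cols_index) auto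
  have "(first_cols r U *\<^sub>v c) $ i = (\<Sum>j<r. U $$ (i, j) * c $ j)"
    using F i c by (simp add: scalar_prod_def lessThan_atLeast0 entry)
  also have "\<dots> = (\<Sum>j<k. if j < r then U $$ (i, j) * c $ j else 0)"
    by (rule sum_extend_zero[OF r])
  also have "\<dots> = (U *\<^sub>v zero_pad k c) $ i"
    using U i c
    by (auto simp: scalar_prod_def lessThan_atLeast0 zero_pad_def intro!: sum.cong)
  finally show "(first_cols r U *\<^sub>v c) $ i = (U *\<^sub>v zero_pad k c) $ i" .
qed (use U first_cols_carrier[OF U r] in auto)

lemma sym_part_quadratic_form:
  fixes G :: "real mat"
  assumes G: "G \<in> carrier_mat r r" and c: "c \<in> carrier_vec r"
  shows "c \<bullet> (sym_part G *\<^sub>v c) = c \<bullet> (G *\<^sub>v c)"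
proof -
  have Gc: "G *\<^sub>v c \<in> carrier_vec r" using G c by auto
  have one: "1 \<cdot>\<^sub>m G\<^sup>T = G\<^sup>T" by (intro eq_matI) auto
  have "c \<bullet> (sym_part G *\<^sub>v c) = (1 / 2) * (c \<bullet> ((G + 1 \<cdot>\<^sub>m G\<^sup>T) *\<^sub>v c))"
    unfolding sym_part_def one using G c by (subst smult_mat_scalar_prod[of _ r r]) auto
  also have "\<dots> = (1 / 2) * (c \<bullet> (G *\<^sub>v c) + c \<bullet> (G\<^sup>T *\<^sub>v c))"
    using G c by (subst perturbed_mat_scalar_prod[of _ r r]) auto
  also have "c \<bullet> (G\<^sup>T *\<^sub>v c) = (G\<^sup>T *\<^sub>v c) \<bullet> c" using G c by (intro comm_scalar_prod) auto
  also have "\<dots> = c \<bullet> (G *\<^sub>v c)" by (rule transpose_vec_mult_scalar[OF G c c])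
  finally show ?thesis by simp
qed

lemma sym_part_symmetric:
  assumes G: "G \<in> carrier_mat r r"
  shows "sym_part G \<in> carrier_mat r r" and "(sym_part G)\<^sup>T = sym_part G"
  using G unfolding sym_part_def by auto

lemma diagonal_mat_bilinear:
  fixes S :: "real mat"
  assumes S: "S \<in> carrier_mat m n" "diagonal_mat S" and nm: "n \<le> m"
    and x: "x \<in> carrier_vec n" and y: "y \<in> carrier_vec m"
  shows "y \<bullet> (S *\<^sub>v x) = (\<Sum>i<n. S $$ (i, i) * (y $ i * x $ i))"
proof -
  have "y \<bullet> (S *\<^sub>v x) = (\<Sum>i<m. \<Sum>j<n. y $ i * (S $$ (i, j) * x $ j))"
    by (rule bilinear_form_sum[OF S(1) x y])
  also have "\<dots> = (\<Sum>i<m. \<Sum>j<n. if i = j then S $$ (j, j) * (y $ j * x $ j) else 0)"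
    using S unfolding diagonal_mat_def by (intro sum.cong refl) auto
  also have "\<dots> = (\<Sum>i<m. if i < n then S $$ (i, i) * (y $ i * x $ i) else 0)"
    by (intro sum.cong refl) auto
  also have "\<dots> = (\<Sum>i<n. S $$ (i, i) * (y $ i * x $ i))"
    by (rule sum_extend_zero[OF nm, symmetric])
  finally show ?thesis .
qed

text \<open>The quantitative heart of the upper bound.  Read \<open>x\<close> and \<open>y\<close> as unit vectors in singular
coordinates, \<open>s\<close> as the singular values, the first \<open>r\<close> of them equal to \<open>\<sigma>\<close>.  The form can come
close to \<open>\<sigma>\<close> only if both vectors are close to one common vector supported on the first \<open>r\<close>
coordinates, and the deficit is at least \<open>\<kappa>\<close> times the squared distance.  The estimate holds index by
index: \<open>2 x y = x\<^sup>2 + y\<^sup>2 - (x - y)\<^sup>2\<close> on the first \<open>r\<close> indices and \<open>2 x y \<le> x\<^sup>2 + y\<^sup>2\<close> on the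
others.  With \<open>\<kappa> = 0\<close> and \<open>r = 0\<close> it is the plain bound of the form by the largest entry.\<close>

lemma diagonal_form_gap:
  fixes s x y :: "nat \<Rightarrow> real"
  assumes nm: "n \<le> m" and \<kappa>: "0 \<le> \<kappa>" "2 * \<kappa> \<le> \<sigma>"
    and top: "\<And>i. i < r \<Longrightarrow> i < n \<Longrightarrow> s i = \<sigma>"
    and rest: "\<And>i. r \<le> i \<Longrightarrow> i < n \<Longrightarrow> 0 \<le> s i \<and> s i \<le> \<sigma> - 2 * \<kappa>"
    and r: "r \<le> n"
  shows "(\<Sum>i<n. s i * (y i * x i)) \<le> \<sigma> / 2 * ((\<Sum>i<n. (x i)\<^sup>2) + (\<Sum>i<m. (y i)\<^sup>2))
    - \<kappa> * ((\<Sum>i<n. (if i < r then 0 else x i)\<^sup>2) + (\<Sum>i<m. (y i - (if i < r then x i else 0))\<^sup>2))"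
proof -
  define z where "z i = (if i < n then x i else 0)" for i
  have "(if i < n then s i * (y i * x i) else 0) \<le> \<sigma> / 2 * ((z i)\<^sup>2 + (y i)\<^sup>2)
      - \<kappa> * ((if i < r then 0 else z i)\<^sup>2 + (y i - (if i < r then x i else 0))\<^sup>2)" for i
  proof (cases "i < n")
    case False
    then have "\<kappa> * (y i)\<^sup>2 \<le> \<sigma> / 2 * (y i)\<^sup>2" using \<kappa> by (intro mult_right_mono) auto
    then show ?thesis using False r by (simp add: z_def)
  next
    case True
    show ?thesis
    proof (cases "i < r")
      case i: True
      have "0 \<le> (\<sigma> / 2 - \<kappa>) * (y i - x i)\<^sup>2" using \<kappa> by (intro mult_nonneg_nonneg) auto
      then show ?thesis using i True top[OF i True]
        by (simp add: z_def power2_eq_square field_simps)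
    next
      case i: False
      have "s i * (y i * x i) \<le> s i * (((x i)\<^sup>2 + (y i)\<^sup>2) / 2)"
        using rest[of i] i True sum_squares_bound[of "x i" "y i"]
        by (intro mult_left_mono) (auto simp: mult_ac)
      also have "\<dots> \<le> (\<sigma> - 2 * \<kappa>) * (((x i)\<^sup>2 + (y i)\<^sup>2) / 2)"
        using rest[of i] i True by (intro mult_right_mono) auto
      finally show ?thesis using i True by (simp add: z_def field_simps)
    qed
  qed
  then have "(\<Sum>i<m. if i < n then s i * (y i * x i) else 0) \<le>
      (\<Sum>i<m. \<sigma> / 2 * ((z i)\<^sup>2 + (y i)\<^sup>2)
        - \<kappa> * ((if i < r then 0 else z i)\<^sup>2 + (y i - (if i < r then x i else 0))\<^sup>2))"
    by (intro sum_mono) auto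
  moreover have "(\<Sum>i<n. (x i)\<^sup>2) = (\<Sum>i<m. (z i)\<^sup>2)"
    unfolding sum_extend_zero[OF nm] by (intro sum.cong) (auto simp: z_def)
  moreover have "(\<Sum>i<n. (if i < r then 0 else x i)\<^sup>2) = (\<Sum>i<m. (if i < r then 0 else z i)\<^sup>2)"
    unfolding sum_extend_zero[OF nm] by (intro sum.cong) (auto simp: z_def)
  ultimately show ?thesis
    unfolding sum_extend_zero[OF nm, of "\<lambda>i. s i * (y i * x i)"]
    by (simp add: sum_subtractf sum.distrib sum_distrib_left[symmetric]
        sum_divide_distrib[symmetric])
qed

section \<open>The one-sided derivative of the spectral norm\<close>

lemma downward_closed_eq_lessThan_card:
  fixes T :: "nat set"
  assumes "finite T" and down: "\<And>i j. i \<in> T \<Longrightarrow> j \<le> i \<Longrightarrow> j \<in> T"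
  shows "T = {..<card T}"
proof -
  define k where "k = (LEAST i. i \<notin> T)"
  have "\<exists>i. i \<notin> T" using \<open>finite T\<close> ex_new_if_finite infinite_UNIV_nat by blast
  then have "k \<notin> T" unfolding k_def by (rule LeastI_ex)
  moreover have "i \<in> T" if "i < k" for i using that not_less_Least unfolding k_def by blast
  ultimately have "T = {..<k}" using down by (meson lessThan_iff not_le set_eq_iff)
  then show ?thesis by simp
qed

context
  fixes X U S V :: "real mat" and m n :: nat
  assumes X: "X \<in> carrier_mat m n" and n: "1 \<le> n" and nm: "n \<le> m"
    and svd: "full_svd X U S V"
begin

lemma svd_facts:
  shows svd_U: "U \<in> carrier_mat m m" "U\<^sup>T * U = 1\<^sub>m m"
    and svd_V: "V \<in> carrier_mat n n" "V\<^sup>T * V = 1\<^sub>m n"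
    and svd_S: "S \<in> carrier_mat m n" "diagonal_mat S"
    and svd_S_nonneg: "\<And>i. i < n \<Longrightarrow> 0 \<le> S $$ (i, i)"
    and svd_S_mono: "\<And>i j. i \<le> j \<Longrightarrow> j < n \<Longrightarrow> S $$ (j, j) \<le> S $$ (i, i)"
    and svd_eq: "X = U * S * V\<^sup>T"
  using svd X nm unfolding full_svd_def by (auto simp: min_absorb2)

lemma svd_bilinear:
  assumes x: "x \<in> carrier_vec n" and y: "y \<in> carrier_vec m"
  shows "y \<bullet> (X *\<^sub>v x) = (U\<^sup>T *\<^sub>v y) \<bullet> (S *\<^sub>v (V\<^sup>T *\<^sub>v x))"
  using bilinear_change_basis[of S m n "U\<^sup>T" m "V\<^sup>T" n x y] svd_S(1) svd_U(1) svd_V(1) x y by (simp add: svd_eq)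

text \<open>In singular coordinates the bilinear form of \<open>X\<close> is that of \<open>S\<close>.  It is bounded by the largest
diagonal entry, which the first pair of singular vectors attains.\<close>

lemma spectral_norm_eq_largest_sv: "spectral_norm X = S $$ (0, 0)"
proof (rule antisym)
  have m: "1 \<le> m" using n nm by simp
  show "spectral_norm X \<le> S $$ (0, 0)"
    unfolding spectral_norm_le_iff[OF X n m]
  proof (intro ballI impI)
    fix x y :: "real vec"
    assume xy: "x \<in> carrier_vec n" "y \<in> carrier_vec m" "x \<bullet> x = 1" "y \<bullet> y = 1"
    define x' y' where "x' = V\<^sup>T *\<^sub>v x" and "y' = U\<^sup>T *\<^sub>v y"
    have c: "x' \<in> carrier_vec n" "y' \<in> carrier_vec m"
      unfolding x'_def y'_def using svd_U svd_V xy by auto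
    have u: "x' \<bullet> x' = 1" "y' \<bullet> y' = 1"
      unfolding x'_def y'_def
      using orthogonal_mat_scalar_prod(2)[OF svd_U xy(2) xy(2)]
        orthogonal_mat_scalar_prod(2)[OF svd_V xy(1) xy(1)] xy by auto
    have "y \<bullet> (X *\<^sub>v x) = (\<Sum>i<n. S $$ (i, i) * (y' $ i * x' $ i))"
      unfolding svd_bilinear[OF xy(1,2)] x'_def[symmetric] y'_def[symmetric]
      by (rule diagonal_mat_bilinear[OF svd_S nm c])
    also have "\<dots> \<le> S $$ (0, 0) / 2 * ((\<Sum>i<n. (x' $ i)\<^sup>2) + (\<Sum>i<m. (y' $ i)\<^sup>2))"
      using diagonal_form_gap[OF nm, of 0 "S $$ (0, 0)" 0 "\<lambda>i. S $$ (i, i)" "\<lambda>i. y' $ i" "\<lambda>i. x' $ i"]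
        svd_S_nonneg svd_S_mono n by simp
    also have "\<dots> = S $$ (0, 0)"
      using u c by (simp add: scalar_prod_def lessThan_atLeast0 power2_eq_square)
    finally show "y \<bullet> (X *\<^sub>v x) \<le> S $$ (0, 0)" .
  qed
  define x y where "x = V *\<^sub>v unit_vec n 0" and "y = U *\<^sub>v unit_vec m 0"
  have c: "x \<in> carrier_vec n" "y \<in> carrier_vec m" unfolding x_def y_def using svd_U svd_V by auto
  have u: "x \<bullet> x = 1" "y \<bullet> y = 1"
    unfolding x_def y_def using n m orthogonal_mat_scalar_prod(1)[OF svd_U, of "unit_vec m 0" "unit_vec m 0"]
      orthogonal_mat_scalar_prod(1)[OF svd_V, of "unit_vec n 0" "unit_vec n 0"] by auto
  have "V\<^sup>T *\<^sub>v x = unit_vec n 0" "U\<^sup>T *\<^sub>v y = unit_vec m 0"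
    unfolding x_def y_def
    using assoc_mult_mat_vec[of "V\<^sup>T" n n V n "unit_vec n 0"] svd_U svd_V
      assoc_mult_mat_vec[of "U\<^sup>T" m m U m "unit_vec m 0"] by auto
  then have "y \<bullet> (X *\<^sub>v x) = S $$ (0, 0)"
    unfolding svd_bilinear[OF c] using svd_S n m by simp
  then show "S $$ (0, 0) \<le> spectral_norm X"
    using spectral_norm_bound[OF X n c] u by simp
qed

text \<open>The diagonal is sorted, so the indices of the largest singular value form an initial segment; this
is why the first columns of \<open>U\<close> and \<open>V\<close> are its singular vectors.\<close>

lemma top_indices_eq_lessThan:
  "{i. i < n \<and> S $$ (i, i) = spectral_norm X} = {..<sv_multiplicity S (spectral_norm X)}"
proof -
  define T where "T = {i. i < n \<and> S $$ (i, i) = spectral_norm X}"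
  have card: "sv_multiplicity S (spectral_norm X) = card T"
    unfolding sv_multiplicity_def T_def using svd_S(1) nm by (simp add: min_absorb2)
  have "T = {..<card T}"
  proof (rule downward_closed_eq_lessThan_card)
    show "finite T" unfolding T_def by simp
    show "j \<in> T" if "i \<in> T" "j \<le> i" for i j
      using that svd_S_mono[of j i] svd_S_mono[of 0 j] unfolding T_def spectral_norm_eq_largest_sv by auto
  qed
  then show ?thesis unfolding card T_def .
qed

lemma sv_multiplicity_bounds:
  "1 \<le> sv_multiplicity S (spectral_norm X)" "sv_multiplicity S (spectral_norm X) \<le> n"
proof -
  have "0 \<in> {i. i < n \<and> S $$ (i, i) = spectral_norm X}"
    using n spectral_norm_eq_largest_sv by simp
  then show "1 \<le> sv_multiplicity S (spectral_norm X)" unfolding top_indices_eq_lessThan by simp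
  show "sv_multiplicity S (spectral_norm X) \<le> n"
  proof (rule ccontr)
    assume "\<not> ?thesis"
    then have "n \<in> {i. i < n \<and> S $$ (i, i) = spectral_norm X}" unfolding top_indices_eq_lessThan by simp
    then show False by simp
  qed
qed

lemma spectral_norm_pos:
  assumes "X \<noteq> 0\<^sub>m m n"
  shows "0 < spectral_norm X"
proof (rule ccontr)
  assume "\<not> ?thesis"
  then have "S $$ (i, i) = 0" if "i < n" for i
    using svd_S_mono[OF le0 that] svd_S_nonneg[OF that] spectral_norm_eq_largest_sv by linarith
  then have "S $$ (i, j) = 0" if "i < m" "j < n" for i j
    using that svd_S unfolding diagonal_mat_def by (cases "i = j") auto
  then have "S = 0\<^sub>m m n" using svd_S(1) by (intro eq_matI) auto
  then have "X = 0\<^sub>m m n" using svd_eq svd_U svd_V by simp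
  then show False using assms by simp
qed

text \<open>The second condition on \<open>\<kappa>\<close> makes the gap a gap to \<open>0\<close> as well, the value that the zero rows of
\<open>S\<close> beyond the \<open>n\<close>-th contribute.\<close>

lemma sv_gap:
  assumes "X \<noteq> 0\<^sub>m m n"
  obtains \<kappa> where "0 < \<kappa>" "2 * \<kappa> \<le> spectral_norm X"
    "\<And>i. sv_multiplicity S (spectral_norm X) \<le> i \<Longrightarrow> i < n \<Longrightarrow>
      S $$ (i, i) \<le> spectral_norm X - 2 * \<kappa>"
proof (cases "sv_multiplicity S (spectral_norm X) = n")
  case True
  then show thesis using spectral_norm_pos[OF assms] by (intro that[of "spectral_norm X / 2"]) auto
next
  case False
  define r where "r = sv_multiplicity S (spectral_norm X)"
  have r: "r < n" using False sv_multiplicity_bounds(2) unfolding r_def by simp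
  have "r \<notin> {i. i < n \<and> S $$ (i, i) = spectral_norm X}"
    unfolding top_indices_eq_lessThan r_def[symmetric] by simp
  then have "S $$ (r, r) < spectral_norm X"
    using r svd_S_mono[OF le0 r] spectral_norm_eq_largest_sv by force
  then show thesis
    using svd_S_nonneg[OF r] svd_S_mono[of r]
    by (intro that[of "(spectral_norm X - S $$ (r, r)) / 2"]) (simp_all add: r_def[symmetric] diff_divide_distrib)
qed

context
  fixes D :: "real mat" and r :: nat and R :: "real mat"
  assumes D: "D \<in> carrier_mat m n" and X_nz: "X \<noteq> 0\<^sub>m m n"
    and r_def: "r = sv_multiplicity S (spectral_norm X)"
    and R_def: "R = sym_part ((first_cols r U)\<^sup>T * D * first_cols r V)"
begin

lemma top_multiplicity_bounds: "1 \<le> r" "r \<le> n" "r \<le> m"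
  using sv_multiplicity_bounds nm unfolding r_def by auto

lemma compression_carrier: "(first_cols r U)\<^sup>T * D * first_cols r V \<in> carrier_mat r r"
proof -
  have "(first_cols r U)\<^sup>T \<in> carrier_mat r m"
    using first_cols_carrier[OF svd_U(1) top_multiplicity_bounds(3)] by simp
  from mult_carrier_mat[OF mult_carrier_mat[OF this D] first_cols_carrier[OF svd_V(1) top_multiplicity_bounds(2)]]
  show ?thesis .
qed

lemma compression_symmetric: "R \<in> carrier_mat r r" "R\<^sup>T = R"
proof -
  show "R \<in> carrier_mat r r" "R\<^sup>T = R"
    unfolding R_def by (rule sym_part_symmetric[OF compression_carrier])+
qed

text \<open>The quadratic form of \<open>R\<close> evaluates \<open>D\<close> on pairs of singular vectors of \<open>X\<close> for its largest singular
value: such pairs are exactly those with equal coordinates, supported on the first \<open>r\<close> indices.\<close>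

lemma compression_quadratic_form:
  assumes c: "c \<in> carrier_vec r"
  shows "c \<bullet> (R *\<^sub>v c) = (U *\<^sub>v zero_pad m c) \<bullet> (D *\<^sub>v (V *\<^sub>v zero_pad n c))"
proof -
  note FU = first_cols_carrier[OF svd_U(1) top_multiplicity_bounds(3)] and FV = first_cols_carrier[OF svd_V(1) top_multiplicity_bounds(2)]
  from sym_part_quadratic_form[OF compression_carrier c] bilinear_change_basis[OF D FU FV c c]
  show ?thesis
    unfolding R_def first_cols_mult_vec[OF svd_U(1) top_multiplicity_bounds(3) c]
      first_cols_mult_vec[OF svd_V(1) top_multiplicity_bounds(2) c] by simp
qed

text \<open>A top eigenvector of \<open>R\<close> yields a pair of unit vectors that is optimal for \<open>X\<close>.  Testing the
perturbed matrix with this pair gives the bound.\<close>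

lemma spectral_norm_perturbed_ge:
  "spectral_norm X + t * lambda_max R \<le> spectral_norm (X + t \<cdot>\<^sub>m D)"
proof -
  obtain c where c: "c \<in> carrier_vec r" "c \<bullet> c = 1" and max: "c \<bullet> (R *\<^sub>v c) = lambda_max R"
    using Rayleigh_lambda_max[OF compression_symmetric top_multiplicity_bounds(1)] by blast
  define p q where "p = zero_pad n c" and "q = zero_pad m c"
  have pq: "p \<in> carrier_vec n" "q \<in> carrier_vec m" by (simp_all add: p_def q_def)
  have pq1: "p \<bullet> p = 1" "q \<bullet> q = 1"
    unfolding p_def q_def using zero_pad_scalar_prod_self[OF c(1)] top_multiplicity_bounds c(2) by auto
  define x y where "x = V *\<^sub>v p" and "y = U *\<^sub>v q"
  have xy: "x \<in> carrier_vec n" "y \<in> carrier_vec m" unfolding x_def y_def using svd_U svd_V pq by auto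
  have xy1: "x \<bullet> x = 1" "y \<bullet> y = 1"
    unfolding x_def y_def using orthogonal_mat_scalar_prod(1)[OF svd_U pq(2) pq(2)]
      orthogonal_mat_scalar_prod(1)[OF svd_V pq(1) pq(1)] pq1 by auto
  have "V\<^sup>T *\<^sub>v x = p" "U\<^sup>T *\<^sub>v y = q"
    unfolding x_def y_def
    using assoc_mult_mat_vec[of "V\<^sup>T" n n V n p] svd_U svd_V pq
      assoc_mult_mat_vec[of "U\<^sup>T" m m U m q] by auto
  then have "y \<bullet> (X *\<^sub>v x) = (\<Sum>i<n. S $$ (i, i) * (q $ i * p $ i))"
    unfolding svd_bilinear[OF xy] using diagonal_mat_bilinear[OF svd_S nm pq] by simp
  also have "\<dots> = (\<Sum>i<n. spectral_norm X * (p $ i * p $ i))"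
  proof (intro sum.cong refl)
    fix i assume "i \<in> {..<n}"
    then have i: "i < n" "i < m" using nm by auto
    show "S $$ (i, i) * (q $ i * p $ i) = spectral_norm X * (p $ i * p $ i)"
    proof (cases "i < r")
      case True
      then have "S $$ (i, i) = spectral_norm X" using top_indices_eq_lessThan unfolding r_def by blast
      then show ?thesis using i by (simp add: p_def q_def zero_pad_def)
    next
      case False
      then show ?thesis using i c by (simp add: p_def q_def zero_pad_def)
    qed
  qed
  also have "\<dots> = spectral_norm X"
    using pq1(1) pq(1) by (simp add: scalar_prod_def lessThan_atLeast0 sum_distrib_left[symmetric])
  finally have "y \<bullet> (X *\<^sub>v x) = spectral_norm X" .
  moreover have "y \<bullet> (D *\<^sub>v x) = lambda_max R"
    using compression_quadratic_form[OF c(1)] max by (simp add: x_def y_def p_def q_def)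
  ultimately have "y \<bullet> ((X + t \<cdot>\<^sub>m D) *\<^sub>v x) = spectral_norm X + t * lambda_max R"
    using perturbed_mat_scalar_prod[OF X D xy] by simp
  moreover have "X + t \<cdot>\<^sub>m D \<in> carrier_mat m n" using X D by simp
  ultimately show ?thesis using spectral_norm_bound[OF _ n xy, of "X + t \<cdot>\<^sub>m D"] xy1 by simp
qed

text \<open>Take unit vectors with singular coordinates \<open>a\<close> and \<open>b\<close>, and let \<open>e\<close> be the distance from
\<open>(a, b)\<close> to \<open>(p, q)\<close>, where \<open>p\<close> and \<open>q\<close> are the truncation of \<open>a\<close> to the first \<open>r\<close> coordinates.
The form of \<open>X\<close> loses at least \<open>\<kappa> e\<^sup>2\<close>, by the spectral gap.  The form of \<open>D\<close> exceeds the largest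
eigenvalue of \<open>R\<close> by at most \<open>K e\<close>, since its value at \<open>(p, q)\<close> is a value of the form of \<open>R\<close>.  The
total gain \<open>t K e - \<kappa> e\<^sup>2\<close> is at most \<open>K\<^sup>2 t\<^sup>2 / (4 \<kappa>)\<close>, whatever \<open>e\<close> is.\<close>

lemma spectral_norm_perturbed_le:
  obtains C where "\<And>t. 0 \<le> t \<Longrightarrow>
    spectral_norm (X + t \<cdot>\<^sub>m D) \<le> spectral_norm X + t * lambda_max R + C * t\<^sup>2"
proof -
  obtain \<kappa> where \<kappa>: "0 < \<kappa>" "2 * \<kappa> \<le> spectral_norm X"
    and gap: "\<And>i. r \<le> i \<Longrightarrow> i < n \<Longrightarrow> S $$ (i, i) \<le> spectral_norm X - 2 * \<kappa>"
    using sv_gap[OF X_nz] unfolding r_def by blast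
  define \<sigma> l where "\<sigma> = spectral_norm X" and "l = lambda_max R"
  define D' where "D' = U\<^sup>T * D * V"
  have D': "D' \<in> carrier_mat m n" unfolding D'_def using svd_U svd_V D by auto
  define F where "F = spectral_norm D'"
  have F: "0 \<le> F" unfolding F_def by (rule spectral_norm_nonneg[OF D' n])
  define K where "K = \<bar>l\<bar> + 2 * F"
  have m: "1 \<le> m" using n nm by simp
  have main: "y \<bullet> ((X + t \<cdot>\<^sub>m D) *\<^sub>v x) \<le> \<sigma> + t * l + K\<^sup>2 / (4 * \<kappa>) * t\<^sup>2"
    if t: "0 \<le> t" and xy: "x \<in> carrier_vec n" "y \<in> carrier_vec m" "x \<bullet> x = 1" "y \<bullet> y = 1"
    for t x y
  proof -
    define a b where "a = V\<^sup>T *\<^sub>v x" and "b = U\<^sup>T *\<^sub>v y"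
    have a: "a \<in> carrier_vec n" and b: "b \<in> carrier_vec m"
      unfolding a_def b_def using svd_U svd_V xy by auto
    have a1: "a \<bullet> a = 1" and b1: "b \<bullet> b = 1"
      unfolding a_def b_def
      using orthogonal_mat_scalar_prod(2)[OF svd_U xy(2) xy(2)]
        orthogonal_mat_scalar_prod(2)[OF svd_V xy(1) xy(1)] xy by auto
    define c where "c = vec r (\<lambda>i. a $ i)"
    have c: "c \<in> carrier_vec r" by (simp add: c_def)
    define p q where "p = zero_pad n c" and "q = zero_pad m c"
    have p: "p \<in> carrier_vec n" and q: "q \<in> carrier_vec m" by (simp_all add: p_def q_def)
    define h d where "h = a - p" and "d = b - q"
    have h: "h \<in> carrier_vec n" and d: "d \<in> carrier_vec m"
      unfolding h_def d_def using a b p q by auto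
    have ap: "a = p + h" and bq: "b = q + d"
      unfolding h_def d_def using a b p q by auto
    define e where "e = sqrt (h \<bullet> h + d \<bullet> d)"
    have ee: "e\<^sup>2 = h \<bullet> h + d \<bullet> d"
      using scalar_prod_self_nonneg[of h] scalar_prod_self_nonneg[of d] by (auto simp: e_def)
    have he: "sqrt (h \<bullet> h) \<le> e" and de: "sqrt (d \<bullet> d) \<le> e"
      using scalar_prod_self_nonneg[of h] scalar_prod_self_nonneg[of d] by (auto simp: e_def)

    have p_ix: "p $ i = (if i < r then a $ i else 0)" if "i < n" for i
      using that by (simp add: p_def zero_pad_def c_def)
    have q_ix: "q $ i = (if i < r then a $ i else 0)" if "i < m" for i
      using that by (simp add: q_def zero_pad_def c_def)
    have hh: "h \<bullet> h = (\<Sum>i<n. (if i < r then 0 else a $ i)\<^sup>2)"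
      using a p unfolding h_def
      by (auto simp: scalar_prod_def lessThan_atLeast0 p_ix power2_eq_square intro!: sum.cong)
    have dd: "d \<bullet> d = (\<Sum>i<m. (b $ i - (if i < r then a $ i else 0))\<^sup>2)"
      using b q unfolding d_def
      by (auto simp: scalar_prod_def lessThan_atLeast0 q_ix power2_eq_square intro!: sum.cong)
    have aa: "(\<Sum>i<n. (a $ i)\<^sup>2) = 1" and bb: "(\<Sum>i<m. (b $ i)\<^sup>2) = 1"
      using a1 b1 a b by (simp_all add: scalar_prod_def lessThan_atLeast0 power2_eq_square)
    have top: "S $$ (i, i) = \<sigma>" if "i < r" for i
      using that top_indices_eq_lessThan unfolding r_def \<sigma>_def by blast
    have "y \<bullet> (X *\<^sub>v x) = (\<Sum>i<n. S $$ (i, i) * (b $ i * a $ i))"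
      unfolding svd_bilinear[OF xy(1,2)] a_def[symmetric] b_def[symmetric]
      by (rule diagonal_mat_bilinear[OF svd_S nm a b])
    also have "\<dots> \<le> \<sigma> / 2 * (1 + 1) - \<kappa> * (h \<bullet> h + d \<bullet> d)"
      using diagonal_form_gap[OF nm, of \<kappa> \<sigma> r "\<lambda>i. S $$ (i, i)" "\<lambda>i. b $ i" "\<lambda>i. a $ i"]
        \<kappa> gap top svd_S_nonneg top_multiplicity_bounds(2)
      unfolding hh dd aa bb \<sigma>_def[symmetric] by simp
    finally have X_le: "y \<bullet> (X *\<^sub>v x) \<le> \<sigma> - \<kappa> * e\<^sup>2" unfolding ee by simp

    have pp: "p \<bullet> p = c \<bullet> c" and qq: "q \<bullet> q = c \<bullet> c"
      unfolding p_def q_def using zero_pad_scalar_prod_self[OF c] top_multiplicity_bounds by auto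
    have "p \<bullet> p = (\<Sum>i<n. (if i < r then a $ i else 0)\<^sup>2)"
      using p by (auto simp: scalar_prod_def lessThan_atLeast0 p_ix power2_eq_square intro!: sum.cong)
    then have "(\<Sum>i<n. (a $ i)\<^sup>2) = p \<bullet> p + h \<bullet> h"
      unfolding hh by (simp only: sum.distrib[symmetric]) (intro sum.cong, auto)
    then have ch: "c \<bullet> c = 1 - h \<bullet> h" using aa pp by simp
    then have h1: "h \<bullet> h \<le> 1" and c1: "c \<bullet> c \<le> 1"
      using scalar_prod_self_nonneg[of c] scalar_prod_self_nonneg[of h] by auto
    \<comment> \<open>As \<open>h\<close> has length at most \<open>1\<close>, its squared length is at most its length, hence at most \<open>e\<close>.\<close>
    have "h \<bullet> h = sqrt (h \<bullet> h) * sqrt (h \<bullet> h)" using scalar_prod_self_nonneg[of h] by simp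
    also have "\<dots> \<le> 1 * e"
      using h1 he scalar_prod_self_nonneg[of h] by (intro mult_mono) auto
    finally have hhe: "h \<bullet> h \<le> e" by simp

    have "(U *\<^sub>v b) \<bullet> (D *\<^sub>v (V *\<^sub>v a)) = b \<bullet> (D' *\<^sub>v a)"
      unfolding D'_def by (rule bilinear_change_basis[OF D svd_U(1) svd_V(1) a b, symmetric])
    then have "y \<bullet> (D *\<^sub>v x) = b \<bullet> (D' *\<^sub>v a)"
      unfolding a_def b_def using orthogonal_mat_cancel[OF svd_U xy(2)] orthogonal_mat_cancel[OF svd_V xy(1)]
      by simp
    also have "\<dots> = q \<bullet> (D' *\<^sub>v p) + q \<bullet> (D' *\<^sub>v h) + d \<bullet> (D' *\<^sub>v a)"
    proof -
      have "b \<bullet> (D' *\<^sub>v a) = q \<bullet> (D' *\<^sub>v a) + d \<bullet> (D' *\<^sub>v a)"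
        using bq D' a q d by (simp add: add_scalar_prod_distrib[of _ m])
      also have "D' *\<^sub>v a = D' *\<^sub>v p + D' *\<^sub>v h"
        unfolding ap by (rule mult_add_distrib_mat_vec[OF D' p h])
      also have "q \<bullet> \<dots> = q \<bullet> (D' *\<^sub>v p) + q \<bullet> (D' *\<^sub>v h)"
        using D' p h q by (intro scalar_prod_add_distrib[of _ m]) auto
      finally show ?thesis unfolding ap using mult_add_distrib_mat_vec[OF D' p h] by simp
    qed
    also have "q \<bullet> (D' *\<^sub>v p) = c \<bullet> (R *\<^sub>v c)"
      unfolding compression_quadratic_form[OF c] D'_def p_def q_def
      by (rule bilinear_change_basis[OF D svd_U(1) svd_V(1)]) auto
    also have "c \<bullet> (R *\<^sub>v c) \<le> l * (c \<bullet> c)"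
      using Rayleigh_lambda_max[OF compression_symmetric top_multiplicity_bounds(1)] c unfolding l_def by blast
    also have "l * (c \<bullet> c) = l - l * (h \<bullet> h)" unfolding ch by (simp add: algebra_simps)
    also have "\<dots> \<le> l + \<bar>l\<bar> * e"
    proof -
      have "- l * (h \<bullet> h) \<le> \<bar>l\<bar> * (h \<bullet> h)"
        using scalar_prod_self_nonneg[of h] by (intro mult_right_mono) auto
      also have "\<dots> \<le> \<bar>l\<bar> * e" using hhe by (intro mult_left_mono) auto
      finally show ?thesis by simp
    qed
    also have "q \<bullet> (D' *\<^sub>v h) \<le> F * e"
    proof -
      have "q \<bullet> (D' *\<^sub>v h) \<le> F * (sqrt (q \<bullet> q) * sqrt (h \<bullet> h))"
        unfolding F_def by (rule spectral_norm_bound[OF D' n h q])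
      also have "\<dots> \<le> F * (1 * e)"
        using F qq c1 he scalar_prod_self_nonneg[of h] scalar_prod_self_nonneg[of c]
        by (intro mult_left_mono mult_mono) auto
      finally show ?thesis by simp
    qed
    also have "d \<bullet> (D' *\<^sub>v a) \<le> F * e"
    proof -
      have "d \<bullet> (D' *\<^sub>v a) \<le> F * (sqrt (d \<bullet> d) * sqrt (a \<bullet> a))"
        unfolding F_def by (rule spectral_norm_bound[OF D' n a d])
      also have "\<dots> \<le> F * e" using F de a1 by (simp add: mult_left_mono)
      finally show ?thesis .
    qed
    finally have D_le: "y \<bullet> (D *\<^sub>v x) \<le> l + K * e"
      by (simp add: K_def algebra_simps)

    \<comment> \<open>Completing the square in \<open>e\<close>.\<close>
    have "0 \<le> (2 * \<kappa> * e - t * K)\<^sup>2" by simp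
    then have "t * K * e - \<kappa> * e\<^sup>2 \<le> K\<^sup>2 / (4 * \<kappa>) * t\<^sup>2"
      using \<kappa>(1) by (simp add: field_simps power2_eq_square)
    moreover have "t * (y \<bullet> (D *\<^sub>v x)) \<le> t * (l + K * e)"
      using D_le t by (rule mult_left_mono)
    ultimately show ?thesis
      unfolding perturbed_mat_scalar_prod[OF X D xy(1,2)] using X_le by (simp add: algebra_simps)
  qed
  show thesis
  proof (rule that)
    fix t :: real assume t: "0 \<le> t"
    have XD: "X + t \<cdot>\<^sub>m D \<in> carrier_mat m n" using X D by simp
    show "spectral_norm (X + t \<cdot>\<^sub>m D) \<le> spectral_norm X + t * lambda_max R + K\<^sup>2 / (4 * \<kappa>) * t\<^sup>2"
      unfolding spectral_norm_le_iff[OF XD n m] using main[OF t] unfolding \<sigma>_def l_def by blast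
  qed
qed

lemma gateaux_spectral_norm: "gateaux spectral_norm D X = lambda_max R"
proof -
  obtain C where C: "\<And>t. 0 \<le> t \<Longrightarrow>
      spectral_norm (X + t \<cdot>\<^sub>m D) \<le> spectral_norm X + t * lambda_max R + C * t\<^sup>2"
    using spectral_norm_perturbed_le by blast
  define g where "g t = (spectral_norm (X + t \<cdot>\<^sub>m D) - spectral_norm X) / t" for t
  have "lambda_max R \<le> g t" if "0 < t" for t
    using that spectral_norm_perturbed_ge[of t] by (simp add: g_def field_simps)
  then have lower: "\<forall>\<^sub>F t in at_right 0. lambda_max R \<le> g t"
    by (intro eventually_at_rightI[of 0 1]) auto
  have "g t \<le> lambda_max R + C * t" if "0 < t" for t
    using that C[of t] by (simp add: g_def field_simps power2_eq_square)
  then have upper: "\<forall>\<^sub>F t in at_right 0. g t \<le> lambda_max R + C * t"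
    by (intro eventually_at_rightI[of 0 1]) auto
  have "((\<lambda>t. lambda_max R + C * t) \<longlongrightarrow> lambda_max R + C * 0) (at_right 0)"
    by (intro tendsto_intros)
  then have "((\<lambda>t. lambda_max R + C * t) \<longlongrightarrow> lambda_max R) (at_right 0)" by simp
  from tendsto_sandwich[OF lower upper tendsto_const this]
  show ?thesis unfolding gateaux_def g_def[symmetric] by (intro tendsto_Lim) auto
qed

end

end

theorem proposition5p10:
  fixes A :: "dual mat" and m n :: nat
  assumes "A \<in> carrier_mat m n" and "1 \<le> n" and "n \<le> m"
  shows "(std_mat A \<noteq> 0\<^sub>m m n \<longrightarrow>
           (\<forall>U S V r\<^sub>1 R.
              full_svd (std_mat A) U S V \<longrightarrow>
              r\<^sub>1 = sv_multiplicity S (spectral_norm (std_mat A)) \<longrightarrow>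
              R = sym_part ((first_cols r\<^sub>1 U)\<^sup>T * inf_mat A * first_cols r\<^sub>1 V) \<longrightarrow>
              dual_continuation spectral_norm A =
                of_real (spectral_norm (std_mat A)) + of_real (lambda_max R) * dual_eps)) \<and>
         (std_mat A = 0\<^sub>m m n \<longrightarrow>
           dual_continuation spectral_norm A =
             of_real (spectral_norm (inf_mat A)) * dual_eps)"
proof (intro conjI impI allI)
  have carrier: "std_mat A \<in> carrier_mat m n" "inf_mat A \<in> carrier_mat m n"
    using assms(1) by (simp_all add: std_mat_def inf_mat_def)
  show "dual_continuation spectral_norm A =
      of_real (spectral_norm (std_mat A)) + of_real (lambda_max R) * dual_eps"
    if "std_mat A \<noteq> 0\<^sub>m m n" "full_svd (std_mat A) U S V"
      "r = sv_multiplicity S (spectral_norm (std_mat A))"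
      "R = sym_part ((first_cols r U)\<^sup>T * inf_mat A * first_cols r V)" for U S V r R
    using gateaux_spectral_norm[OF carrier(1) assms(2,3) that(2) carrier(2) that(1,3,4)]
    by (simp add: dual_continuation_def)
  show "dual_continuation spectral_norm A = of_real (spectral_norm (inf_mat A)) * dual_eps"
    if "std_mat A = 0\<^sub>m m n"
    using gateaux_spectral_norm_0[OF carrier(2) assms(2)] assms(2,3) that
    by (simp add: dual_continuation_def)
qed

end
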